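(* Let $f:\mathbb{R}^{n_1}\to\mathbb{R}$ and $g:\mathbb{R}^{n_2}\to\mathbb{R}$ be closed convex functions, $\mathcal{X}\subseteq\mathbb{R}^{n_1}$ and $\mathcal{Y}\subseteq\mathbb{R}^{n_2}$ closed convex sets, $A\in\mathbb{R}^{m\times n_1}$, $B\in\mathbb{R}^{m\times n_2}$, $b\in\mathbb{R}^m$, and assume that the set of KKT points of $$\min_{x,y}\{f(x)+g(y):\ Ax+By=b,\ x\in\mathcal{X},\ y\in\mathcal{Y}\}$$ is nonempty. Let $\Omega^*$ and $G$ be as defined in the context. Let $\beta>0$, $0<\tau<1/\rho(A^TA)$, $0<\eta<1/\rho(B^TB)$, and let $\{\alpha_k\}_{k=0}^\infty$ satisfy, for all $k$, $0\le\alpha_k\le\alpha_{k+1}\le\alpha<\frac13$ (with $\alpha$ independent of $k$). Let $\{(x^k,y^k,p^k)\}_{k=0}^\infty$ be generated, together with $\{(\bar x^k,\bar y^k,\bar p^k)\}_{k=0}^\infty$, by the inertial linearized ADMM (defined in the context) from any starting point $(x^0,y^0,p^0)=(x^{-1},y^{-1},p^{-1})$. Then the sequence $\{(x^k,y^k,p^k)\}_{k=0}^\infty$ converges to some point in $\Omega^*$ as $k\to\infty$. Moreover, as $k\to\infty$, $$\min_{0\le i\le k-1}\big\|(x^{i+1},y^{i+1},p^{i+1})-(\bar x^i,\bar y^i,\bar p^i)\big\|_G^2=o\!\left(\frac1k\right).$$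
   Context: $\rho(M)$ denotes the spectral radius of a square matrix $M$; $\langle\cdot,\cdot\rangle$ and $\|\cdot\|$ are the standard inner product and $\ell_2$ norm; for a symmetric positive semidefinite matrix $G$, $\|u\|_G:=\sqrt{u^TGu}$. Put $\Omega:=\mathcal{X}\times\mathcal{Y}\times\mathbb{R}^m$ and, for $w=(x,y,p)$, $$\theta(w):=f(x)+g(y),\qquad F(w):=\begin{pmatrix} -A^Tp \\ -B^Tp \\ {A}x+By-b \end{pmatrix}.$$ $\Omega^*$ is the set of solutions of the mixed variational inequality problem: $w^*\in\Omega$ with $\theta(w)-\theta(w^* )+\langle w-w^*,F(w^* )\rangle\ge0$ for all $w\in\Omega$ (these are the KKT points of the optimization problem). The matrix $G$ is $$G=\begin{pmatrix}\beta\left(\frac1\tau I-A^TA\right)&0&0\\0&\frac\beta\eta I&-B^T\\0&-B&\frac1\beta I\end{pmatrix},$$ where $I$ denotes the identity matrix of appropriate size. Inertial linearized ADMM: given $(x^k,y^k,p^k)$ and $(x^{k-1},y^{k-1},p^{k-1})$, iterate for $k=0,1,2,\dots$ $$(\bar x^k,\bar y^k,\bar p^k)=(x^k,y^k,p^k)+\alpha_k(x^k-x^{k-1},\,y^k-y^{k-1},\,p^k-p^{k-1}),$$ $$u^k=A^T(A\bar x^k+B\bar y^k-b),$$ $$x^{k+1}=\arg\min_{x\in\mathcal{X}}\ f(x)-\langle\bar p^k,Ax\rangle+\frac{\beta}{2\tau}\|x-(\bar x^k-\tau u^k)\|^2,$$ $$p^{k+1}=\bar p^k-\beta(Ax^{k+1}+B\bar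 y^k-b),$$ $$v^k=B^T(Ax^{k+1}+B\bar y^k-b),$$ $$y^{k+1}=\arg\min_{y\in\mathcal{Y}}\ g(y)-\langle p^{k+1},By\rangle+\frac{\beta}{2\eta}\|y-(\bar y^k-\eta v^k)\|^2 .$$ *)

theory Defs
  imports "HOL-Analysis.Analysis" "HOL-Library.Landau_Symbols"
begin

text \<open>
  The eigenvalues are taken over the complex numbers. The set of their moduli is finite and
  nonempty, so the supremum is the maximum. It can be \<open>0\<close> (for the zero matrix, say), so step-size
  bounds of the form \<open>1 / spectral_radius M\<close> are to be taken in type \<open>ereal\<close>, where \<open>1 / 0 = \<infinity>\<close>.
\<close>

definition complex_eigenvalues :: "real^'n^'n \<Rightarrow> complex set" where
  "complex_eigenvalues M =
     {c. \<exists>v :: complex^'n. v \<noteq> 0 \<and> map_matrix complex_of_real M *v v = c *s v}"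

definition spectral_radius :: "real^'n^'n \<Rightarrow> real" where
  "spectral_radius M = (SUP c\<in>complex_eigenvalues M. cmod c)"

text \<open>
  A point \<open>w = (x, y, p)\<close> lives in a product of Euclidean spaces, whose library inner product
  and norm are those of the stacked vector.
\<close>

type_synonym ('n1, 'n2, 'm) triple = "(real^'n1) \<times> (real^'n2) \<times> (real^'m)"

definition Omega :: "(real^'n1) set \<Rightarrow> (real^'n2) set \<Rightarrow> ('n1, 'n2, 'm) triple set" where
  "Omega X Y = X \<times> Y \<times> UNIV"

definition theta ::
  "(real^'n1 \<Rightarrow> real) \<Rightarrow> (real^'n2 \<Rightarrow> real) \<Rightarrow> ('n1, 'n2, 'm) triple \<Rightarrow> real" where
  "theta f g = (\<lambda>(x, y, p). f x + g y)"

definition F_op ::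
  "real^'n1^'m \<Rightarrow> real^'n2^'m \<Rightarrow> real^'m \<Rightarrow>
   ('n1, 'n2, 'm) triple \<Rightarrow> ('n1, 'n2, 'm) triple" where
  "F_op A B b = (\<lambda>(x, y, p).
     (- (transpose A *v p), - (transpose B *v p), A *v x + B *v y - b))"

text \<open>
  Solutions of the mixed variational inequality; these are the KKT points of minimizing
  \<open>f x + g y\<close> subject to \<open>A x + B y = b\<close>, \<open>x \<in> X\<close>, \<open>y \<in> Y\<close>, with multiplier \<open>p\<close>.
\<close>

definition Omega_star ::
  "(real^'n1 \<Rightarrow> real) \<Rightarrow> (real^'n2 \<Rightarrow> real) \<Rightarrow> (real^'n1) set \<Rightarrow> (real^'n2) set \<Rightarrow>
   real^'n1^'m \<Rightarrow> real^'n2^'m \<Rightarrow> real^'m \<Rightarrow> ('n1, 'n2, 'm) triple set" where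
  "Omega_star f g X Y A B b =
     {ws \<in> Omega X Y. \<forall>w \<in> Omega X Y.
        theta f g w - theta f g ws + (w - ws) \<bullet> F_op A B b ws \<ge> 0}"

text \<open>
  The action on \<open>(x, y, p)\<close> of the block matrix with rows
  \<open>(\<beta> (I/\<tau> - A\<^sup>T A), 0, 0)\<close>, \<open>(0, (\<beta>/\<eta>) I, - B\<^sup>T)\<close> and \<open>(0, - B, (1/\<beta>) I)\<close>.
\<close>

definition G_op ::
  "real \<Rightarrow> real \<Rightarrow> real \<Rightarrow> real^'n1^'m \<Rightarrow> real^'n2^'m \<Rightarrow>
   ('n1, 'n2, 'm) triple \<Rightarrow> ('n1, 'n2, 'm) triple" where
  "G_op \<beta> \<tau> \<eta> A B = (\<lambda>(x, y, p).
     ((\<beta> *\<^sub>R ((1/\<tau>) *\<^sub>R mat 1 - transpose A ** A)) *v x,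
      ((\<beta>/\<eta>) *\<^sub>R mat 1) *v y + (- transpose B) *v p,
      (- B) *v y + ((1/\<beta>) *\<^sub>R mat 1) *v p))"

definition norm_wrt :: "('a::real_inner \<Rightarrow> 'a) \<Rightarrow> 'a \<Rightarrow> real" where
  "norm_wrt G u = sqrt (u \<bullet> G u)"

text \<open>
  One pass from the extrapolated point \<open>(xb, yb, pb)\<close> to the next iterate \<open>(x, y, p)\<close>.
  The two vectors in the proximal terms are the \<open>u\<^sup>k\<close> and \<open>v\<^sup>k\<close> of the method.
\<close>

definition lin_admm_step ::
  "(real^'n1 \<Rightarrow> real) \<Rightarrow> (real^'n2 \<Rightarrow> real) \<Rightarrow> (real^'n1) set \<Rightarrow> (real^'n2) set \<Rightarrow>
   real^'n1^'m \<Rightarrow> real^'n2^'m \<Rightarrow> real^'m \<Rightarrow> real \<Rightarrow> real \<Rightarrow> real \<Rightarrow>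
   ('n1, 'n2, 'm) triple \<Rightarrow> ('n1, 'n2, 'm) triple \<Rightarrow> bool" where
  "lin_admm_step f g X Y A B b \<beta> \<tau> \<eta> = (\<lambda>(xb, yb, pb) (x, y, p).
     let u = transpose A *v (A *v xb + B *v yb - b);
         v = transpose B *v (A *v x + B *v yb - b)
     in is_arg_min
          (\<lambda>x'. f x' - pb \<bullet> (A *v x') + \<beta> / (2 * \<tau>) * (norm (x' - (xb - \<tau> *\<^sub>R u)))\<^sup>2)
          (\<lambda>x'. x' \<in> X) x \<and>
        p = pb - \<beta> *\<^sub>R (A *v x + B *v yb - b) \<and>
        is_arg_min
          (\<lambda>y'. g y' - p \<bullet> (B *v y') + \<beta> / (2 * \<eta>) * (norm (y' - (yb - \<eta> *\<^sub>R v)))\<^sup>2)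
          (\<lambda>y'. y' \<in> Y) y)"

text \<open>
  The sequence \<open>w\<close> is indexed from \<open>0\<close>; \<open>wm1\<close> is the additional starting point with
  index \<open>-1\<close>.
\<close>

definition inertial_lin_admm ::
  "(real^'n1 \<Rightarrow> real) \<Rightarrow> (real^'n2 \<Rightarrow> real) \<Rightarrow> (real^'n1) set \<Rightarrow> (real^'n2) set \<Rightarrow>
   real^'n1^'m \<Rightarrow> real^'n2^'m \<Rightarrow> real^'m \<Rightarrow> real \<Rightarrow> real \<Rightarrow> real \<Rightarrow> (nat \<Rightarrow> real) \<Rightarrow>
   ('n1, 'n2, 'm) triple \<Rightarrow>
   (nat \<Rightarrow> ('n1, 'n2, 'm) triple) \<Rightarrow> (nat \<Rightarrow> ('n1, 'n2, 'm) triple) \<Rightarrow> bool" where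
  "inertial_lin_admm f g X Y A B b \<beta> \<tau> \<eta> \<alpha> wm1 w wbar \<longleftrightarrow>
     (\<forall>k. wbar k = w k + \<alpha> k *\<^sub>R (w k - (case k of 0 \<Rightarrow> wm1 | Suc j \<Rightarrow> w j)) \<and>
          lin_admm_step f g X Y A B b \<beta> \<tau> \<eta> (wbar k) (w (Suc k)))"

end

theory Submission
  imports Defs
begin

text \<open>
  The optimality conditions of the two subproblems combine into the variational inequality
  \<open>\<theta>(w) - \<theta>(w\<^sup>k\<^sup>+\<^sup>1) + \<langle>w - w\<^sup>k\<^sup>+\<^sup>1, F(w\<^sup>k\<^sup>+\<^sup>1) + G(w\<^sup>k\<^sup>+\<^sup>1 - wbar\<^sup>k)\<rangle> \<ge> 0\<close>, so the method is an
  inertial proximal point iteration in the metric of \<open>G\<close>, which is positive definite by the step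
  size conditions. As \<open>F\<close> is affine with skew-symmetric linear part, every solution \<open>s\<close> satisfies
  \<open>\<langle>w\<^sup>k\<^sup>+\<^sup>1 - s, G(w\<^sup>k\<^sup>+\<^sup>1 - wbar\<^sup>k)\<rangle> \<le> 0\<close>. With \<open>\<phi>\<^sub>k = \<parallel>w\<^sup>k - s\<parallel>\<^sup>2\<close> and \<open>d\<^sub>k = \<parallel>w\<^sup>k - w\<^sup>k\<^sup>-\<^sup>1\<parallel>\<^sup>2\<close>
  in the \<open>G\<close>-norm, the quantity \<open>\<phi>\<^sub>k - \<alpha>\<^sub>k \<phi>\<^sub>k\<^sub>-\<^sub>1 + 2 \<alpha>\<^sub>k d\<^sub>k\<close> then decreases by at least
  \<open>(1 - 3\<alpha>) d\<^sub>k\<^sub>+\<^sub>1\<close>. Hence \<open>d\<close> is summable and \<open>\<phi>\<close> converges for every \<open>s\<close>, and since cluster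
  points are solutions, Opial's argument gives convergence. Summability of the squared
  \<open>G\<close>-distances from \<open>w\<^sup>k\<^sup>+\<^sup>1\<close> to \<open>wbar\<^sup>k\<close> gives the rate.
\<close>

section \<open>Optimality conditions of the proximal subproblems\<close>

text \<open>Dividing by \<open>t\<close> and letting \<open>t\<close> tend to 0 from the right
  leaves \<open>a\<close>, whatever the sign of \<open>c\<close>. This turns extremality along a
  line or segment into a first-order condition.\<close>

lemma nonneg_if_perturbed_nonneg:
  fixes a c :: real
  assumes "\<And>t. 0 < t \<Longrightarrow> t \<le> 1 \<Longrightarrow> 0 \<le> t * a + t\<^sup>2 * c"
  shows "0 \<le> a"
proof -
  have "((\<lambda>t. a + t * c) \<longlongrightarrow> a + 0 * c) (at_right 0)"
    by (intro tendsto_intros)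
  moreover have "\<forall>\<^sub>F t in at_right 0. 0 \<le> a + t * c"
    unfolding eventually_at_right_field
  proof (intro exI[of _ 1] conjI allI impI)
    fix t :: real
    assume t: "0 < t" "t < 1"
    have "0 \<le> t * (a + t * c)"
      using assms[of t] t by (simp add: algebra_simps power2_eq_square)
    then show "0 \<le> a + t * c" using t by (simp add: zero_le_mult_iff)
  qed simp
  ultimately have "0 \<le> a + 0 * c"
    by (intro tendsto_lowerbound) auto
  then show ?thesis by simp
qed

text \<open>Compare \<open>x\<close> with a point at parameter \<open>t\<close> on the segment to
  \<open>z\<close>: convexity bounds \<open>f\<close> there, and expanding the square leaves a
  remainder of second order in \<open>t\<close>.\<close>

lemma is_arg_min_prox_imp_variational_ineq:
  fixes f :: "'a::real_inner \<Rightarrow> real"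
  assumes f: "convex_on UNIV f" and X: "convex X"
    and min: "is_arg_min (\<lambda>x. f x - l \<bullet> x + r * (norm (x - c))\<^sup>2) (\<lambda>x. x \<in> X) x"
    and z: "z \<in> X"
  shows "0 \<le> f z - f x + (z - x) \<bullet> ((2 * r) *\<^sub>R (x - c) - l)"
proof (rule nonneg_if_perturbed_nonneg[where c = "r * (norm (z - x))\<^sup>2"])
  fix t :: real
  assume t: "0 < t" "t \<le> 1"
  let ?u = "(1 - t) *\<^sub>R x + t *\<^sub>R z"
  have x: "x \<in> X" using min by (simp add: is_arg_min_def)
  have "?u \<in> X" using X x z t by (intro convexD) auto
  then have "f x - l \<bullet> x + r * (norm (x - c))\<^sup>2 \<le> f ?u - l \<bullet> ?u + r * (norm (?u - c))\<^sup>2"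
    using min by (auto simp: is_arg_min_linorder)
  also have "f ?u \<le> (1 - t) * f x + t * f z"
    using t by (intro convex_onD[OF f]) auto
  finally have "0 \<le> t * (f z - f x) - (l \<bullet> ?u - l \<bullet> x)
      + r * ((norm (?u - c))\<^sup>2 - (norm (x - c))\<^sup>2)"
    by (simp add: algebra_simps)
  also have "?u - c = (x - c) + t *\<^sub>R (z - x)"
    by (simp add: algebra_simps)
  also have "(norm ((x - c) + t *\<^sub>R (z - x)))\<^sup>2 - (norm (x - c))\<^sup>2
      = 2 * t * ((z - x) \<bullet> (x - c)) + t\<^sup>2 * (norm (z - x))\<^sup>2"
    unfolding power2_norm_eq_inner inner_add_left inner_add_right inner_scaleR_left
      inner_scaleR_right inner_commute[of "x - c" "z - x"]
    by (simp add: power2_eq_square ring_distribs)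
  also have "l \<bullet> ?u - l \<bullet> x = t * ((z - x) \<bullet> l)"
    by (simp add: algebra_simps inner_commute)
  finally show "0 \<le> t * (f z - f x + (z - x) \<bullet> ((2 * r) *\<^sub>R (x - c) - l))
      + t\<^sup>2 * (r * (norm (z - x))\<^sup>2)"
    by (simp add: algebra_simps inner_diff_right)
qed

section \<open>Spectral radius and the step size bounds\<close>

text \<open>A real supremum is informative only for a set bounded above. In an eigenvector, the row
  of the entry of largest modulus bounds \<open>cmod c\<close> by a sum of absolute matrix
  entries.\<close>

lemma bdd_above_cmod_complex_eigenvalues:
  "bdd_above (cmod ` complex_eigenvalues (M :: real^'n^'n))"
proof (rule bdd_aboveI2)
  fix c
  assume "c \<in> complex_eigenvalues M"
  then obtain v :: "complex^'n" where v: "v \<noteq> 0"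
    and eq: "map_matrix complex_of_real M *v v = c *s v"
    by (auto simp: complex_eigenvalues_def)
  let ?S = "range (\<lambda>i. cmod (v $ i))"
  have "Max ?S \<in> ?S" by (intro Max_in) auto
  then obtain i where i: "Max ?S = cmod (v $ i)" by (rule rangeE)
  have le: "cmod (v $ j) \<le> cmod (v $ i)" for j
    unfolding i[symmetric] by (intro Max_ge) auto
  from v obtain j where "v $ j \<noteq> 0" by (auto simp: vec_eq_iff)
  with le[of j] have pos: "0 < cmod (v $ i)"
    by (meson order_less_le_trans zero_less_norm_iff)
  have "cmod c * cmod (v $ i) = cmod ((map_matrix complex_of_real M *v v) $ i)"
    by (simp add: eq norm_mult)
  also have "\<dots> = cmod (\<Sum>j\<in>UNIV. complex_of_real (M $ i $ j) * v $ j)"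
    by (simp add: matrix_vector_mult_def map_matrix_def)
  also have "\<dots> \<le> (\<Sum>j\<in>UNIV. \<bar>M $ i $ j\<bar> * cmod (v $ i))"
    by (intro sum_norm_le) (auto simp: norm_mult intro!: mult_left_mono le)
  also have "\<dots> \<le> (\<Sum>i\<in>UNIV. \<Sum>j\<in>UNIV. \<bar>M $ i $ j\<bar>) * cmod (v $ i)"
    unfolding sum_distrib_right[symmetric]
    by (intro mult_right_mono member_le_sum) (auto intro: sum_nonneg)
  finally show "cmod c \<le> (\<Sum>i\<in>UNIV. \<Sum>j\<in>UNIV. \<bar>M $ i $ j\<bar>)"
    using pos by simp
qed

lemma transpose_inner: "(transpose A *v p) \<bullet> x = p \<bullet> (A *v (x :: real^'n))"
  by (metis dot_lmul_matrix transpose_matrix_vector)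

lemma inner_transpose: "x \<bullet> (transpose A *v p) = (A *v (x :: real^'n)) \<bullet> p"
  by (metis inner_commute transpose_inner)

text \<open>The maximum \<open>l\<close> of the squared norm of \<open>A *v u\<close> over the unit
  sphere is itself an eigenvalue of \<open>transpose A ** A\<close>, hence at most the spectral
  radius; homogeneity extends the bound to all vectors.\<close>

lemma norm_matrix_vector_le_spectral_radius:
  fixes A :: "real^'n^'m"
  shows "(norm (A *v x))\<^sup>2 \<le> spectral_radius (transpose A ** A) * (norm x)\<^sup>2"
proof -
  let ?S = "sphere 0 1 :: (real^'n) set"
  have "\<exists>v\<in>?S. \<forall>u\<in>?S. (norm (A *v u))\<^sup>2 \<le> (norm (A *v v))\<^sup>2"
    by (intro continuous_attains_sup continuous_intros linear_continuous_on
        matrix_vector_mul_bounded_linear) auto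
  then obtain v where v: "norm v = 1"
    and max: "\<And>u. norm u = 1 \<Longrightarrow> (norm (A *v u))\<^sup>2 \<le> (norm (A *v v))\<^sup>2"
    by auto
  define l where "l = (norm (A *v v))\<^sup>2"
  have le: "(norm (A *v u))\<^sup>2 \<le> l * (norm u)\<^sup>2" for u
  proof (cases "u = 0")
    case False
    have "(norm (A *v ((1 / norm u) *\<^sub>R u)))\<^sup>2 \<le> l"
      unfolding l_def using False by (intro max) simp
    then show ?thesis
      using False by (simp add: matrix_vector_mult_scaleR power_mult_distrib field_simps)
  qed simp
  \<comment> \<open>First-order optimality of the maximizer \<open>v\<close>; this makes \<open>v\<close> an eigenvector.\<close>
  have ge: "0 \<le> l * (v \<bullet> h) - (A *v v) \<bullet> (A *v h)" for h
  proof -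
    have "0 \<le> 2 * (l * (v \<bullet> h) - (A *v v) \<bullet> (A *v h))"
    proof (rule nonneg_if_perturbed_nonneg[where c = "l * (h \<bullet> h) - (A *v h) \<bullet> (A *v h)"])
      fix t :: real
      show "0 \<le> t * (2 * (l * (v \<bullet> h) - (A *v v) \<bullet> (A *v h)))
          + t\<^sup>2 * (l * (h \<bullet> h) - (A *v h) \<bullet> (A *v h))"
        using le[of "v + t *\<^sub>R h"] v
        unfolding power2_norm_eq_inner matrix_vector_right_distrib matrix_vector_mult_scaleR
          inner_add_left inner_add_right inner_scaleR_left inner_scaleR_right
          inner_commute[of h v] inner_commute[of "A *v h" "A *v v"]
        using l_def[unfolded power2_norm_eq_inner] v[unfolded norm_eq_1]
        by (simp add: algebra_simps power2_eq_square)
    qed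
    then show ?thesis by simp
  qed
  \<comment> \<open>The one-sided condition for both \<open>h\<close> and \<open>- h\<close> gives
    equality.\<close>
  have "(transpose A *v (A *v v)) \<bullet> h = (l *\<^sub>R v) \<bullet> h" for h
    using ge[of h] ge[of "- h"]
    by (simp add: transpose_inner linear_neg[OF matrix_vector_mul_linear]
        del: transpose_matrix_vector)
  then have ev: "(transpose A ** A) *v v = l *\<^sub>R v"
    by (metis matrix_vector_mul_assoc vector_eq_rdot)
  \<comment> \<open>Eigenvalues are defined through complex vectors, so the real eigenvector is
    embedded entrywise.\<close>
  let ?v = "\<chi> i. complex_of_real (v $ i)"
  have "map_matrix complex_of_real (transpose A ** A) *v ?v = complex_of_real l *s ?v"
  proof (subst vec_eq_iff, rule allI)
    fix i
    have "(map_matrix complex_of_real (transpose A ** A) *v ?v) $ i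
        = complex_of_real (((transpose A ** A) *v v) $ i)"
      by (simp add: matrix_vector_mult_def map_matrix_def)
    then show "(map_matrix complex_of_real (transpose A ** A) *v ?v) $ i
        = (complex_of_real l *s ?v) $ i"
      by (simp add: ev)
  qed
  moreover from v have "v \<noteq> 0" by auto
  then have "?v \<noteq> 0" by (simp add: vec_eq_iff)
  ultimately have "complex_of_real l \<in> complex_eigenvalues (transpose A ** A)"
    unfolding complex_eigenvalues_def by blast
  then have "cmod (complex_of_real l) \<le> spectral_radius (transpose A ** A)"
    unfolding spectral_radius_def
    by (intro cSUP_upper bdd_above_cmod_complex_eigenvalues)
  then have "l * (norm x)\<^sup>2 \<le> spectral_radius (transpose A ** A) * (norm x)\<^sup>2"
    by (intro mult_right_mono) auto
  with le[of x] show ?thesis by linarith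
qed

lemma step_size_bound:
  fixes A :: "real^'n^'m"
  assumes "0 < \<tau>" and "ereal \<tau> < 1 / ereal (spectral_radius (transpose A ** A))"
    and "x \<noteq> 0"
  shows "(norm (A *v x))\<^sup>2 < (norm x)\<^sup>2 / \<tau>"
proof -
  let ?r = "spectral_radius (transpose A ** A)"
  have x: "0 < (norm x)\<^sup>2" using assms(3) by simp
  have "0 \<le> ?r * (norm x)\<^sup>2"
    using norm_matrix_vector_le_spectral_radius[of A x] by (meson order_trans zero_le_power2)
  then have r: "0 \<le> ?r" using x by (simp add: zero_le_mult_iff)
  have "\<tau> * ?r < 1"
  \<comment> \<open>For radius 0 the bound is \<open>1 / 0 = \<infinity>\<close> and puts no limit
    on \<open>\<tau>\<close>; otherwise the \<open>ereal\<close> quotient is the real one.\<close>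
  proof (cases "?r = 0")
    case False
    then have "\<tau> < 1 / ?r"
      using assms(2) by (simp add: one_ereal_def)
    then show ?thesis using False r by (simp add: field_simps)
  qed simp
  then have "?r < 1 / \<tau>" using assms(1) by (simp add: field_simps)
  then have "?r * (norm x)\<^sup>2 < 1 / \<tau> * (norm x)\<^sup>2" using x by (rule mult_strict_right_mono)
  with norm_matrix_vector_le_spectral_radius[of A x] show ?thesis by simp
qed

section \<open>Algebra of the operators \<open>G_op\<close> and \<open>F_op\<close>\<close>

lemma G_op_apply:
  "G_op \<beta> \<tau> \<eta> A B (x, y, p) =
    ((\<beta> / \<tau>) *\<^sub>R x - \<beta> *\<^sub>R (transpose A *v (A *v x)),
     (\<beta> / \<eta>) *\<^sub>R y - transpose B *v p,
     (1 / \<beta>) *\<^sub>R p - B *v y)"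
proof -
  have neg: "(- M) *v v = - (M *v v)" for M :: "real^'k^'l" and v
    by (simp add: vec_eq_iff matrix_vector_mult_def sum_negf)
  show ?thesis
    unfolding G_op_def
    by (simp add: neg scaleR_matrix_vector_assoc[symmetric] matrix_vector_mult_diff_rdistrib
        matrix_vector_mul_assoc scaleR_diff_right)
qed

lemma linear_G_op: "linear (G_op \<beta> \<tau> \<eta> A B)"
  by (rule linearI)
    (auto simp: G_op_apply matrix_vector_right_distrib matrix_vector_mult_scaleR
      algebra_simps simp del: transpose_matrix_vector)

lemma inner_G_op:
  "(x, y, p) \<bullet> G_op \<beta> \<tau> \<eta> A B (x', y', p') =
    \<beta> * (x \<bullet> x' / \<tau> - (A *v x) \<bullet> (A *v x')) +
    (\<beta> * (y \<bullet> y') / \<eta> - (B *v y) \<bullet> p') + (p \<bullet> p' / \<beta> - p \<bullet> (B *v y'))"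
  by (simp add: G_op_apply inner_diff_right inner_transpose algebra_simps
      del: transpose_matrix_vector)

lemma G_op_selfadjoint: "u \<bullet> G_op \<beta> \<tau> \<eta> A B v = v \<bullet> G_op \<beta> \<tau> \<eta> A B u"
  by (cases u; cases v) (simp add: inner_G_op inner_commute)

text \<open>Completing the square in \<open>p\<close> decouples the form into summands in
  \<open>x\<close>, in \<open>y\<close> and in \<open>p - \<beta> *\<^sub>R (B *v y)\<close>; the
  step size bounds make the first two positive for nonzero \<open>x\<close> and
  \<open>y\<close>.\<close>

lemma G_op_pos:
  assumes \<beta>: "0 < \<beta>"
    and "0 < \<tau>" "ereal \<tau> < 1 / ereal (spectral_radius (transpose A ** A))"
    and "0 < \<eta>" "ereal \<eta> < 1 / ereal (spectral_radius (transpose B ** B))"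
    and u: "u \<noteq> 0"
  shows "0 < u \<bullet> G_op \<beta> \<tau> \<eta> A B u"
proof -
  obtain x y p where xyp: "u = (x, y, p)" by (cases u)
  have A: "(norm (A *v x))\<^sup>2 < (norm x)\<^sup>2 / \<tau>" if "x \<noteq> 0"
    using assms that by (intro step_size_bound)
  have B: "(norm (B *v y))\<^sup>2 < (norm y)\<^sup>2 / \<eta>" if "y \<noteq> 0"
    using assms that by (intro step_size_bound)
  have eq: "u \<bullet> G_op \<beta> \<tau> \<eta> A B u =
      \<beta> * ((norm x)\<^sup>2 / \<tau> - (norm (A *v x))\<^sup>2) + \<beta> * ((norm y)\<^sup>2 / \<eta> - (norm (B *v y))\<^sup>2)
      + (norm (p - \<beta> *\<^sub>R (B *v y)))\<^sup>2 / \<beta>"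
    unfolding xyp inner_G_op power2_norm_eq_inner inner_diff_left inner_diff_right
      inner_scaleR_left inner_scaleR_right inner_commute[of "B *v y" p]
    using \<beta> by (simp add: field_simps)
  have "0 \<le> \<beta> * ((norm x)\<^sup>2 / \<tau> - (norm (A *v x))\<^sup>2)"
    using A \<beta> by (cases "x = 0") auto
  moreover have "0 \<le> \<beta> * ((norm y)\<^sup>2 / \<eta> - (norm (B *v y))\<^sup>2)"
    using B \<beta> by (cases "y = 0") auto
  moreover have "0 \<le> (norm (p - \<beta> *\<^sub>R (B *v y)))\<^sup>2 / \<beta>"
    using \<beta> by simp
  \<comment> \<open>Some summand is strictly positive: if \<open>x\<close> and \<open>y\<close>
    vanish, the last one is \<open>(norm p)\<^sup>2 / \<beta>\<close>.\<close>
  moreover consider "x \<noteq> 0" | "y \<noteq> 0" | "x = 0" "y = 0" "p \<noteq> 0"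
    using u by (auto simp: xyp zero_prod_def)
  then have "0 < \<beta> * ((norm x)\<^sup>2 / \<tau> - (norm (A *v x))\<^sup>2) \<or>
      0 < \<beta> * ((norm y)\<^sup>2 / \<eta> - (norm (B *v y))\<^sup>2) \<or>
      0 < (norm (p - \<beta> *\<^sub>R (B *v y)))\<^sup>2 / \<beta>"
    by cases (use A B \<beta> in auto)
  ultimately show ?thesis unfolding eq by linarith
qed

text \<open>The linear part of \<open>F_op\<close> is skew-symmetric, so the difference of its
  values is orthogonal to \<open>w - w'\<close>. This allows evaluating it at a test point instead
  of at an iterate.\<close>

lemma F_op_skew: "(w - w') \<bullet> F_op A B b w = (w - w') \<bullet> F_op A B b w'"
proof -
  obtain x y p x' y' p' where w: "w = (x, y, p)" "w' = (x', y', p')"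
    by (cases w; cases w') auto
  show ?thesis
    unfolding w F_op_def
    by (simp add: inner_transpose matrix_vector_mult_diff_distrib inner_diff_left inner_diff_right
        inner_add_right inner_commute del: transpose_matrix_vector)
qed

section \<open>One pass of the method as a variational inequality\<close>

lemma lin_admm_step_in_Omega:
  assumes "lin_admm_step f g X Y A B b \<beta> \<tau> \<eta> wb wn"
  shows "wn \<in> Omega X Y"
  using assms
  by (auto simp: lin_admm_step_def Omega_def Let_def is_arg_min_def split: prod.splits)

text \<open>The first two components of the sum of \<open>F_op\<close> and \<open>G_op\<close> are
  the gradients of the smooth parts of the two subproblems, and the third is 0. The claim is thus
  the sum of two optimality conditions.\<close>

lemma lin_admm_step_variational_ineq:
  assumes f: "convex_on UNIV f" and g: "convex_on UNIV g"
    and X: "convex X" and Y: "convex Y" and pos: "0 < \<beta>" "0 < \<tau>" "0 < \<eta>"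
    and step: "lin_admm_step f g X Y A B b \<beta> \<tau> \<eta> wb wn"
    and z: "z \<in> Omega X Y"
  shows "0 \<le> theta f g z - theta f g wn
           + (z - wn) \<bullet> (F_op A B b wn + G_op \<beta> \<tau> \<eta> A B (wn - wb))"
proof -
  obtain xb yb pb x y p where w: "wb = (xb, yb, pb)" "wn = (x, y, p)"
    by (cases wb; cases wn) auto
  obtain x' y' p' where z': "z = (x', y', p')" by (cases z)
  define u where "u = transpose A *v (A *v xb + B *v yb - b)"
  define v where "v = transpose B *v (A *v x + B *v yb - b)"
  have minx: "is_arg_min (\<lambda>x'. f x' - (transpose A *v pb) \<bullet> x'
        + \<beta> / (2 * \<tau>) * (norm (x' - (xb - \<tau> *\<^sub>R u)))\<^sup>2) (\<lambda>x'. x' \<in> X) x"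
    and p: "p = pb - \<beta> *\<^sub>R (A *v x + B *v yb - b)"
    and miny: "is_arg_min (\<lambda>y'. g y' - (transpose B *v p) \<bullet> y'
        + \<beta> / (2 * \<eta>) * (norm (y' - (yb - \<eta> *\<^sub>R v)))\<^sup>2) (\<lambda>y'. y' \<in> Y) y"
    using step unfolding w lin_admm_step_def Let_def u_def v_def transpose_inner by auto
  have x': "x' \<in> X" and y': "y' \<in> Y" using z by (auto simp: z' Omega_def)
  \<comment> \<open>Replacing \<open>pb\<close> by \<open>p\<close> brings in the residual at
    \<open>x\<close>, while \<open>u\<close> holds the one at \<open>xb\<close>; their difference is
    the \<open>A\<close> term of the first block of \<open>G_op\<close>.\<close>
  have gx: "(2 * (\<beta> / (2 * \<tau>))) *\<^sub>R (x - (xb - \<tau> *\<^sub>R u)) - transpose A *v pb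
      = - (transpose A *v p) + ((\<beta> / \<tau>) *\<^sub>R (x - xb) - \<beta> *\<^sub>R (transpose A *v (A *v (x - xb))))"
    using pos unfolding p u_def
    by (simp add: algebra_simps matrix_vector_right_distrib matrix_vector_mult_diff_distrib
        matrix_vector_mult_scaleR)
  \<comment> \<open>By the update of \<open>p\<close>, \<open>\<beta> *\<^sub>R v\<close> equals
    \<open>- (transpose B *v (p - pb))\<close>, the off-diagonal block.\<close>
  have gy: "(2 * (\<beta> / (2 * \<eta>))) *\<^sub>R (y - (yb - \<eta> *\<^sub>R v)) - transpose B *v p
      = - (transpose B *v p) + ((\<beta> / \<eta>) *\<^sub>R (y - yb) - transpose B *v (p - pb))"
    using pos unfolding p v_def
    by (simp add: algebra_simps matrix_vector_right_distrib matrix_vector_mult_diff_distrib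
        matrix_vector_mult_scaleR)
  \<comment> \<open>This is the multiplier update rewritten; since it is an equation,
    \<open>p'\<close> is arbitrary.\<close>
  have gp: "(A *v x + B *v y - b) + ((1 / \<beta>) *\<^sub>R (p - pb) - B *v (y - yb)) = 0"
    using pos unfolding p
    by (simp add: algebra_simps matrix_vector_mult_diff_distrib)
  have FG: "F_op A B b wn + G_op \<beta> \<tau> \<eta> A B (wn - wb) =
      ((2 * (\<beta> / (2 * \<tau>))) *\<^sub>R (x - (xb - \<tau> *\<^sub>R u)) - transpose A *v pb,
       (2 * (\<beta> / (2 * \<eta>))) *\<^sub>R (y - (yb - \<eta> *\<^sub>R v)) - transpose B *v p, 0)"
    unfolding gx gy unfolding gp[symmetric] w by (simp add: F_op_def G_op_apply)
  show ?thesis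
    using is_arg_min_prox_imp_variational_ineq[OF f X minx x']
      is_arg_min_prox_imp_variational_ineq[OF g Y miny y']
    unfolding FG unfolding w z' theta_def by simp
qed

section \<open>The rate from summability\<close>

lemma smallo_Min_of_summable:
  fixes a :: "nat \<Rightarrow> real"
  assumes sum: "summable a" and nn: "\<And>n. 0 \<le> a n"
  shows "(\<lambda>k. MIN i\<in>{0..k-1}. a i) \<in> o(\<lambda>k. 1 / real k)"
proof (rule smalloI_tendsto)
  define m where "m k = (MIN i\<in>{0..k-1}. a i)" for k
  have m0: "0 \<le> m k" for k unfolding m_def by (intro Min.boundedI) (auto simp: nn)
  \<comment> \<open>The minimum is at most the average over the second half of the indices, whose sum is a
    Cauchy tail.\<close>
  have bound: "real k * m k \<le> 2 * (sum a {..<k} - sum a {..<k div 2})" for k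
  proof -
    have "real (k - k div 2) * m k \<le> (\<Sum>i\<in>{k div 2..<k}. a i)"
    proof -
      have "m k \<le> a i" if "i \<in> {k div 2..<k}" for i
        unfolding m_def using that by (intro Min_le) auto
      from sum_bounded_below[of "{k div 2..<k}" "m k" a, OF this] show ?thesis by simp
    qed
    also have "\<dots> = sum a {..<k} - sum a {..<k div 2}"
      using sum_diff_nat_ivl[of 0 "k div 2" k a] by (simp add: atLeast0LessThan)
    finally have le: "real (k - k div 2) * m k \<le> sum a {..<k} - sum a {..<k div 2}" .
    have "real k * m k \<le> (2 * real (k - k div 2)) * m k"
      by (intro mult_right_mono m0) linarith
    also have "\<dots> = 2 * (real (k - k div 2) * m k)" by simp
    also have "\<dots> \<le> 2 * (sum a {..<k} - sum a {..<k div 2})"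
      using le by (intro mult_left_mono) auto
    finally show ?thesis .
  qed
  have lim: "(\<lambda>k. sum a {..<k}) \<longlonglongrightarrow> suminf a" using sum by (rule summable_LIMSEQ)
  have "(\<lambda>k. sum a {..<k div 2}) \<longlonglongrightarrow> suminf a"
    using filterlim_compose[OF lim] filterlim_at_top_div_const_nat[of 2] by fastforce
  then have "(\<lambda>k. 2 * (sum a {..<k} - sum a {..<k div 2})) \<longlonglongrightarrow> 2 * (suminf a - suminf a)"
    by (intro tendsto_intros lim)
  then have "(\<lambda>k. 2 * (sum a {..<k} - sum a {..<k div 2})) \<longlonglongrightarrow> 0" by simp
  then have "(\<lambda>k. real k * m k) \<longlonglongrightarrow> 0"
    by (rule tendsto_sandwich[of "\<lambda>_. 0", rotated 3])
      (use bound in \<open>simp_all add: m0\<close>)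
  then show "((\<lambda>k. (MIN i\<in>{0..k-1}. a i) / (1 / real k)) \<longlonglongrightarrow> 0)"
    by (simp add: m_def mult.commute)
  \<comment> \<open>For \<open>k = 0\<close> the comparison function is \<open>1 / 0 = 0\<close>, so
    it is nonzero only eventually.\<close>
  show "\<forall>\<^sub>F k in sequentially. 1 / real k \<noteq> 0"
    using eventually_gt_at_top[of 0] by eventually_elim simp
qed

section \<open>The scalar recursion of inertial methods\<close>

text \<open>A Lyapunov function first bounds \<open>\<phi>\<close> and the sums of \<open>d\<close>;
  then the increases of \<open>\<phi>\<close> are summable, which forces convergence. In the
  application \<open>d k\<close> measures the step between the points of \<open>\<phi> k\<close> and
  \<open>\<phi> (Suc k)\<close>.\<close>

lemma inertial_recursion:
  fixes \<phi> d \<alpha> :: "nat \<Rightarrow> real"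
  assumes \<phi>0: "\<And>k. 0 \<le> \<phi> k" and d0: "\<And>k. 0 \<le> d k"
    and \<alpha>: "\<And>k. 0 \<le> \<alpha> k" "\<And>k. \<alpha> k \<le> \<alpha> (Suc k)" "\<And>k. \<alpha> k \<le> a" and a: "a < 1/3"
    and rec: "\<And>k. \<phi> (Suc (Suc k)) - \<phi> (Suc k)
       \<le> \<alpha> k * (\<phi> (Suc k) - \<phi> k) - (1 - \<alpha> k) * d (Suc k) + 2 * \<alpha> k * d k"
  shows "bdd_above (range \<phi>)" and "summable d" and "convergent \<phi>"
proof -
  have a0: "0 \<le> a" using \<alpha>(1)[of 0] \<alpha>(3)[of 0] by linarith
  define \<mu> where "\<mu> k = \<phi> (Suc k) - \<alpha> k * \<phi> k + 2 * \<alpha> k * d k" for k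
  \<comment> \<open>\<open>\<mu>\<close> is the Lyapunov function: since \<open>\<alpha>\<close> is nondecreasing and below \<open>1/3\<close>, each step
    decreases it by a fixed multiple of \<open>d\<close>.\<close>
  have \<mu>_step: "\<mu> (Suc k) \<le> \<mu> k - (1 - 3 * a) * d (Suc k)" for k
  proof -
    have "\<mu> (Suc k) - \<mu> k \<le> - (1 - \<alpha> k - 2 * \<alpha> (Suc k)) * d (Suc k)"
      using rec[of k] mult_right_mono[OF \<alpha>(2)[of k] \<phi>0[of "Suc k"]]
      by (simp add: \<mu>_def algebra_simps)
    also have "\<dots> \<le> - (1 - 3 * a) * d (Suc k)"
      using \<alpha>(3)[of k] \<alpha>(3)[of "Suc k"] d0 by (intro mult_right_mono) auto
    finally show ?thesis by (simp add: algebra_simps)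
  qed
  have \<mu>_sum: "\<mu> n + (1 - 3 * a) * (\<Sum>k<n. d (Suc k)) \<le> \<mu> 0" for n
  proof (induction n)
    case (Suc n)
    then show ?case using \<mu>_step[of n] by (simp add: algebra_simps)
  qed simp
  have \<mu>_le: "\<mu> n \<le> \<mu> 0" for n
  proof -
    have "0 \<le> (1 - 3 * a) * (\<Sum>k<n. d (Suc k))"
      using a d0 by (intro mult_nonneg_nonneg sum_nonneg) auto
    with \<mu>_sum[of n] show ?thesis by linarith
  qed
  have \<mu>_ge: "\<phi> (Suc k) - a * \<phi> k \<le> \<mu> k" for k
    using mult_right_mono[OF \<alpha>(3)[of k] \<phi>0[of k]] mult_nonneg_nonneg[OF \<alpha>(1)[of k] d0[of k]]
    by (simp add: \<mu>_def)
  \<comment> \<open>\<open>C\<close> dominates \<open>\<phi> 0\<close> and is preserved by the map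
    taking \<open>t\<close> to \<open>a * t + \<bar>\<mu> 0\<bar>\<close>, which bounds the next
    value of \<open>\<phi>\<close>.\<close>
  define C where "C = \<phi> 0 + \<bar>\<mu> 0\<bar> / (1 - a)"
  have C: "\<phi> k \<le> C" for k
  proof (induction k)
    case 0
    show ?case using a by (simp add: C_def)
  next
    case (Suc k)
    have "\<phi> (Suc k) \<le> a * C + \<bar>\<mu> 0\<bar>"
      using \<mu>_ge[of k] \<mu>_le[of k] mult_left_mono[OF Suc a0] by linarith
    also have "\<bar>\<mu> 0\<bar> = (1 - a) * (\<bar>\<mu> 0\<bar> / (1 - a))" using a by simp
    also have "\<dots> \<le> (1 - a) * C"
      using \<phi>0[of 0] a by (intro mult_left_mono) (auto simp: C_def)
    finally show ?case by (simp add: algebra_simps)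
  qed
  then show "bdd_above (range \<phi>)" by (rule bdd_aboveI2)
  \<comment> \<open>\<open>\<mu>\<close> is bounded below by \<open>- (a * C)\<close>, so its
    telescoped decrease bounds the partial sums; \<open>a < 1/3\<close> makes the divisor
    positive.\<close>
  have "(\<Sum>k<n. d (Suc k)) \<le> (\<mu> 0 + a * C) / (1 - 3 * a)" for n
  proof -
    have "- (a * C) \<le> \<mu> n"
      using \<mu>_ge[of n] \<phi>0[of "Suc n"] mult_left_mono[OF C[of n] a0] by linarith
    then have "(1 - 3 * a) * (\<Sum>k<n. d (Suc k)) \<le> \<mu> 0 + a * C"
      using \<mu>_sum[of n] by linarith
    then show ?thesis using a by (simp add: field_simps)
  qed
  then have "summable (\<lambda>k. d (Suc k))"
    by (intro summableI_nonneg_bounded) (auto simp: d0)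
  then show sum: "summable d" by (simp only: summable_Suc_iff)
  \<comment> \<open>The positive parts of the increments shrink by the factor \<open>a < 1\<close>
    up to the summable error \<open>d\<close>, hence are summable.\<close>
  define q where "q k = max 0 (\<phi> (Suc k) - \<phi> k)" for k
  have q0: "0 \<le> q k" for k by (simp add: q_def)
  have q_step: "q (Suc k) \<le> a * q k + d k" for k
  proof -
    have "\<alpha> k * (\<phi> (Suc k) - \<phi> k) \<le> \<alpha> k * q k"
      using \<alpha>(1) by (intro mult_left_mono) (auto simp: q_def)
    also have "\<dots> \<le> a * q k" using \<alpha>(3) q0 by (intro mult_right_mono)
    finally have 1: "\<alpha> k * (\<phi> (Suc k) - \<phi> k) \<le> a * q k" .
    have 2: "0 \<le> (1 - \<alpha> k) * d (Suc k)"
      using \<alpha>(3)[of k] a d0 by simp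
    have 3: "2 * \<alpha> k * d k \<le> 1 * d k"
      using \<alpha>(3)[of k] a d0 by (intro mult_right_mono) auto
    have "\<phi> (Suc (Suc k)) - \<phi> (Suc k) \<le> a * q k + d k" using rec[of k] 1 2 3 by linarith
    moreover have "0 \<le> a * q k + d k" using a0 q0 d0 by simp
    ultimately show ?thesis by (simp add: q_def)
  qed
  have "(\<Sum>k<n. q k) \<le> (q 0 + suminf d) / (1 - a)" for n
  proof -
    have "(\<Sum>k<Suc n. q k) = q 0 + (\<Sum>k<n. q (Suc k))"
      by (rule sum.lessThan_Suc_shift)
    also have "(\<Sum>k<n. q (Suc k)) \<le> (\<Sum>k<n. a * q k + d k)"
      by (intro sum_mono q_step)
    also have "\<dots> = a * (\<Sum>k<n. q k) + (\<Sum>k<n. d k)"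
      by (simp add: sum.distrib sum_distrib_left)
    also have "(\<Sum>k<n. d k) \<le> suminf d"
      using sum d0 by (intro sum_le_suminf) auto
    finally have "(1 - a) * (\<Sum>k<n. q k) \<le> q 0 + suminf d"
      using q0[of n] by (simp add: algebra_simps)
    then show ?thesis using a by (simp add: field_simps)
  qed
  then have sumq: "summable q"
    by (intro summableI_nonneg_bounded) (auto simp: q0)
  \<comment> \<open>Subtracting the accumulated increases leaves a nonincreasing sequence bounded
    below.\<close>
  have dec: "decseq (\<lambda>n. \<phi> n - sum q {..<n})"
    by (rule decseq_SucI) (auto simp: q_def)
  have lower: "\<forall>n. - suminf q \<le> \<phi> n - sum q {..<n}"
  proof
    fix n
    have "sum q {..<n} \<le> suminf q" using q0 by (intro sum_le_suminf sumq) auto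
    with \<phi>0[of n] show "- suminf q \<le> \<phi> n - sum q {..<n}" by linarith
  qed
  obtain L where "(\<lambda>n. \<phi> n - sum q {..<n}) \<longlonglongrightarrow> L"
    using decseq_convergent[OF dec lower] by blast
  then have "(\<lambda>n. (\<phi> n - sum q {..<n}) + sum q {..<n}) \<longlonglongrightarrow> L + suminf q"
    by (intro tendsto_add summable_LIMSEQ sumq)
  then show "convergent \<phi>" by (auto simp: convergent_def)
qed

section \<open>Inertial proximal point iteration in a positive definite metric\<close>

text \<open>The unit sphere is compact, so the form attains a positive minimum there, which serves
  as \<open>c\<close>; homogeneity of degree 2 does the rest.\<close>

lemma pos_quadratic_form_coercive:
  fixes G :: "'a::euclidean_space \<Rightarrow> 'a"
  assumes G: "linear G" and pos: "\<And>u. u \<noteq> 0 \<Longrightarrow> 0 < u \<bullet> G u"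
  obtains c where "0 < c" "\<And>u. c * (norm u)\<^sup>2 \<le> u \<bullet> G u"
proof -
  have "\<exists>v\<in>sphere 0 1. \<forall>u\<in>sphere 0 1. v \<bullet> G v \<le> u \<bullet> G u"
    using G by (intro continuous_attains_inf continuous_intros linear_continuous_on)
      (auto simp: linear_conv_bounded_linear)
  then obtain v where v: "norm v = 1"
    and min: "\<And>u. norm u = 1 \<Longrightarrow> v \<bullet> G v \<le> u \<bullet> G u" by auto
  show ?thesis
  proof
    show "0 < v \<bullet> G v" using v by (intro pos) auto
    fix u
    show "v \<bullet> G v * (norm u)\<^sup>2 \<le> u \<bullet> G u"
    proof (cases "u = 0")
      case False
      then have "v \<bullet> G v \<le> ((1 / norm u) *\<^sub>R u) \<bullet> G ((1 / norm u) *\<^sub>R u)"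
        by (intro min) simp
      then show ?thesis
        using False by (simp add: linear_cmul[OF G] field_simps power2_eq_square)
    qed (simp add: linear_0[OF G])
  qed
qed

text \<open>
  Here \<open>v (Suc k)\<close> is the \<open>k\<close>-th iterate, so \<open>v 0\<close> has index \<open>-1\<close>.
\<close>

lemma inertial_proximal_point_convergence:
  fixes G :: "'a::euclidean_space \<Rightarrow> 'a" and v vb :: "nat \<Rightarrow> 'a"
  assumes G: "linear G" and sym: "\<And>u u'. u \<bullet> G u' = u' \<bullet> G u"
    and pos: "\<And>u. u \<noteq> 0 \<Longrightarrow> 0 < u \<bullet> G u"
    and \<alpha>: "\<And>k. 0 \<le> \<alpha> k" "\<And>k. \<alpha> k \<le> \<alpha> (Suc k)" "\<And>k. \<alpha> k \<le> a" and a: "a < 1/3"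
    and vb: "\<And>k. vb k = v (Suc k) + \<alpha> k *\<^sub>R (v (Suc k) - v k)"
    and S: "S \<noteq> {}"
    and fejer: "\<And>s k. s \<in> S \<Longrightarrow> (v (Suc (Suc k)) - s) \<bullet> G (v (Suc (Suc k)) - vb k) \<le> 0"
    and cluster: "\<And>l r. strict_mono r \<Longrightarrow> (\<lambda>k. v (Suc (Suc (r k)))) \<longlonglongrightarrow> l \<Longrightarrow>
        (\<lambda>k. v (Suc (Suc k)) - vb k) \<longlonglongrightarrow> 0 \<Longrightarrow> l \<in> S"
  shows "\<exists>s\<in>S. v \<longlonglongrightarrow> s"
    and "summable (\<lambda>k. (v (Suc (Suc k)) - vb k) \<bullet> G (v (Suc (Suc k)) - vb k))"
proof -
  define N where "N u = u \<bullet> G u" for u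
  obtain c where c: "0 < c" "\<And>u. c * (norm u)\<^sup>2 \<le> N u"
    using pos_quadratic_form_coercive[OF G pos] unfolding N_def by metis
  have N0: "0 \<le> N u" for u
    using c(2)[of u] c(1) by (meson mult_nonneg_nonneg order_trans less_imp_le zero_le_power2)
  have N_add: "N (x + t *\<^sub>R y) = N x + 2 * t * (x \<bullet> G y) + t\<^sup>2 * N y" for x y t
    unfolding N_def using sym[of y x]
    by (simp add: linear_add[OF G] linear_cmul[OF G] inner_add_left inner_add_right
        power2_eq_square algebra_simps)
  have N_diff: "N (x - y) = N x - 2 * (x \<bullet> G y) + N y" for x y
    using N_add[of x "-1" y] by simp
  have N_tendsto: "(\<lambda>k. N (u k)) \<longlonglongrightarrow> N l" if "u \<longlonglongrightarrow> l" for u l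
    unfolding N_def using that G
    by (intro tendsto_inner bounded_linear.tendsto[of G]) (auto simp: linear_conv_bounded_linear)
  have N_zero: "u \<longlonglongrightarrow> 0" if "(\<lambda>k. N (u k)) \<longlonglongrightarrow> 0" for u :: "nat \<Rightarrow> 'a"
  proof -
    have "(\<lambda>k. N (u k) / c) \<longlonglongrightarrow> 0" using tendsto_divide[OF that tendsto_const[of c]] c(1) by simp
    then have "(\<lambda>k. (norm (u k))\<^sup>2) \<longlonglongrightarrow> 0"
    proof (rule tendsto_sandwich[of "\<lambda>_. 0", rotated 3])
      show "\<forall>\<^sub>F k in sequentially. (norm (u k))\<^sup>2 \<le> N (u k) / c"
        using c by (simp add: pos_le_divide_eq mult.commute)
    qed auto
    then have "(\<lambda>k. sqrt ((norm (u k))\<^sup>2)) \<longlonglongrightarrow> sqrt 0" by (intro tendsto_intros)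
    then show ?thesis by (simp add: tendsto_norm_zero_iff)
  qed
  define d where "d k = N (v (Suc k) - v k)" for k
  define e where "e k = N (v (Suc (Suc k)) - vb k)" for k
  have d0: "0 \<le> d k" and e0: "0 \<le> e k" for k by (simp_all add: d_def e_def N0)
  have e_eq: "e k = d (Suc k) - 2 * \<alpha> k * ((v (Suc (Suc k)) - v (Suc k)) \<bullet> G (v (Suc k) - v k))
      + (\<alpha> k)\<^sup>2 * d k" for k
  proof -
    have "v (Suc (Suc k)) - vb k
        = (v (Suc (Suc k)) - v (Suc k)) + (- \<alpha> k) *\<^sub>R (v (Suc k) - v k)"
      by (simp add: vb)
    then show ?thesis unfolding e_def d_def by (simp only: N_add) simp
  qed
  \<comment> \<open>Nonnegativity of \<open>N\<close> at \<open>x - y\<close> and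
    \<open>x + y\<close>. The first bound serves to estimate \<open>e k\<close> from below, the
    second from above.\<close>
  have cross: "2 * (x \<bullet> G y) \<le> N x + N y" "- 2 * (x \<bullet> G y) \<le> N x + N y" for x y
    using N0[of "x - y"] N_add[of x 1 y] N0[of "x + y"] by (auto simp: N_diff)
  have e_ge: "(1 - \<alpha> k) * d (Suc k) + ((\<alpha> k)\<^sup>2 - \<alpha> k) * d k \<le> e k" for k
    using mult_left_mono[OF cross(1)[of "v (Suc (Suc k)) - v (Suc k)" "v (Suc k) - v k"] \<alpha>(1)[of k]]
    unfolding e_eq by (simp add: d_def algebra_simps)
  \<comment> \<open>Writing \<open>N (vb k - s)\<close> through the two previous distances gives
    \<open>d k\<close> the coefficient \<open>\<alpha> k + (\<alpha> k)\<^sup>2\<close>; the lower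
    bound on \<open>e k\<close> cancels the square and leaves \<open>2 * \<alpha> k\<close>.\<close>
  have rec: "N (v (Suc (Suc k)) - s) - N (v (Suc k) - s)
      \<le> \<alpha> k * (N (v (Suc k) - s) - N (v k - s)) - (1 - \<alpha> k) * d (Suc k) + 2 * \<alpha> k * d k"
    if s: "s \<in> S" for s k
  proof -
    have "vb k - s = (v (Suc (Suc k)) - s) - (v (Suc (Suc k)) - vb k)" by simp
    then have "N (vb k - s) = N (v (Suc (Suc k)) - s)
        - 2 * ((v (Suc (Suc k)) - s) \<bullet> G (v (Suc (Suc k)) - vb k)) + e k"
      unfolding e_def by (metis N_diff)
    then have 1: "N (v (Suc (Suc k)) - s) \<le> N (vb k - s) - e k"
      using fejer[OF s, of k] by linarith
    have "vb k - s = (v (Suc k) - s) + \<alpha> k *\<^sub>R (v (Suc k) - v k)" by (simp add: vb)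
    then have 2: "N (vb k - s) = N (v (Suc k) - s)
        + 2 * \<alpha> k * ((v (Suc k) - s) \<bullet> G (v (Suc k) - v k)) + (\<alpha> k)\<^sup>2 * d k"
      unfolding d_def by (metis N_add)
    have "v k - s = (v (Suc k) - s) - (v (Suc k) - v k)" by simp
    then have 3: "N (v k - s) = N (v (Suc k) - s)
        - 2 * ((v (Suc k) - s) \<bullet> G (v (Suc k) - v k)) + d k"
      unfolding d_def by (metis N_diff)
    have "N (vb k - s) = N (v (Suc k) - s) + \<alpha> k * (N (v (Suc k) - s) - N (v k - s))
        + (\<alpha> k + (\<alpha> k)\<^sup>2) * d k"
      unfolding 2 3 by (simp add: algebra_simps)
    with 1 e_ge[of k] show ?thesis by (simp add: algebra_simps)
  qed
  have inertial: "bdd_above (range (\<lambda>k. N (v k - s)))" "summable d" "convergent (\<lambda>k. N (v k - s))"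
    if "s \<in> S" for s
    by (rule inertial_recursion[where d = d, OF N0 d0 \<alpha> a rec[OF that]])+
  obtain s0 where s0: "s0 \<in> S" using S by blast
  have sum_d: "summable d" using inertial(2)[OF s0] .
  have e_le: "e k \<le> 2 * d (Suc k) + 2 * d k" for k
  proof -
    have 1: "0 \<le> \<alpha> k" "\<alpha> k \<le> 1" using \<alpha>(1,3)[of k] a by auto
    have "e k \<le> d (Suc k) + \<alpha> k * (d (Suc k) + d k) + (\<alpha> k)\<^sup>2 * d k"
      using mult_left_mono[OF cross(2)[of "v (Suc (Suc k)) - v (Suc k)" "v (Suc k) - v k"] 1(1)]
      unfolding e_eq by (simp add: d_def algebra_simps)
    moreover have "\<alpha> k * (d (Suc k) + d k) \<le> 1 * (d (Suc k) + d k)"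
      using 1 d0 by (intro mult_right_mono) auto
    moreover have "(\<alpha> k)\<^sup>2 * d k \<le> 1 * d k"
      using 1 d0 by (intro mult_right_mono) (auto simp: power_le_one)
    ultimately show ?thesis by simp
  qed
  have "summable (\<lambda>k. 2 * d (Suc k) + 2 * d k)"
    using sum_d by (intro summable_add summable_mult) (simp_all only: summable_Suc_iff)
  then have sum_e: "summable e"
    by (rule summable_comparison_test') (use e_le e0 in auto)
  then show "summable (\<lambda>k. (v (Suc (Suc k)) - vb k) \<bullet> G (v (Suc (Suc k)) - vb k))"
    by (simp add: e_def[abs_def] N_def)
  have e_lim: "(\<lambda>k. v (Suc (Suc k)) - vb k) \<longlonglongrightarrow> 0"
    using summable_LIMSEQ_zero[OF sum_e] by (intro N_zero) (simp add: e_def[abs_def])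
  obtain C where C: "\<And>k. N (v k - s0) \<le> C"
    using inertial(1)[OF s0] by (auto simp: bdd_above_def)
  have "bounded (range (\<lambda>k. v (Suc (Suc k))))"
  proof -
    have "norm (v (Suc (Suc k)) - s0) \<le> sqrt (C / c)" for k
    proof (rule real_le_rsqrt)
      show "(norm (v (Suc (Suc k)) - s0))\<^sup>2 \<le> C / c"
        using c(2)[of "v (Suc (Suc k)) - s0"] C[of "Suc (Suc k)"] c(1) by (simp add: field_simps)
    qed
    then show ?thesis by (auto simp: bounded_any_center[of _ s0] dist_norm norm_minus_commute)
  qed
  then obtain l r where r: "strict_mono r" and l: "((\<lambda>k. v (Suc (Suc k))) \<circ> r) \<longlonglongrightarrow> l"
    using bounded_imp_convergent_subsequence by blast
  have lS: "l \<in> S" using cluster[OF r _ e_lim, of l] l by (simp add: o_def)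
  \<comment> \<open>Opial's argument: the distances to the cluster point \<open>l\<close> converge
    because \<open>l\<close> is in \<open>S\<close>, and along the subsequence they tend to
    0.\<close>
  obtain L where L: "(\<lambda>k. N (v k - l)) \<longlonglongrightarrow> L"
    using inertial(3)[OF lS] by (auto simp: convergent_def)
  have "strict_mono (\<lambda>k. Suc (Suc (r k)))" using r by (simp add: strict_mono_def)
  from LIMSEQ_subseq_LIMSEQ[OF L this] have "(\<lambda>k. N (v (Suc (Suc (r k))) - l)) \<longlonglongrightarrow> L"
    by (simp add: o_def)
  moreover have "(\<lambda>k. N (v (Suc (Suc (r k))) - l)) \<longlonglongrightarrow> N (l - l)"
    using l by (intro N_tendsto tendsto_intros) (simp add: o_def)
  ultimately have "L = 0" using LIMSEQ_unique by (fastforce simp: N_def)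
  with L have "(\<lambda>k. v k - l) \<longlonglongrightarrow> 0" by (intro N_zero) simp
  then have "v \<longlonglongrightarrow> l" using Lim_null by blast
  with lS show "\<exists>s\<in>S. v \<longlonglongrightarrow> s" by blast
qed

section \<open>Application to the inertial linearized ADMM\<close>

theorem theorem5:
  fixes f :: "real^'n1 \<Rightarrow> real" and g :: "real^'n2 \<Rightarrow> real"
    and X :: "(real^'n1) set" and Y :: "(real^'n2) set"
    and A :: "real^'n1^'m" and B :: "real^'n2^'m" and b :: "real^'m"
    and \<beta> \<tau> \<eta> \<alpha>max :: real and \<alpha> :: "nat \<Rightarrow> real"
    and wm1 :: "('n1, 'n2, 'm) triple"
    and w wbar :: "nat \<Rightarrow> ('n1, 'n2, 'm) triple"
  assumes "convex_on UNIV f" and "closed (epigraph UNIV f)"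
    and "convex_on UNIV g" and "closed (epigraph UNIV g)"
    and "closed X" and "convex X" and "closed Y" and "convex Y"
    and "Omega_star f g X Y A B b \<noteq> {}"
    and "\<beta> > 0"
    and "0 < \<tau>" and "ereal \<tau> < 1 / ereal (spectral_radius (transpose A ** A))"
    and "0 < \<eta>" and "ereal \<eta> < 1 / ereal (spectral_radius (transpose B ** B))"
    and "\<forall>k. 0 \<le> \<alpha> k \<and> \<alpha> k \<le> \<alpha> (Suc k) \<and> \<alpha> (Suc k) \<le> \<alpha>max" and "\<alpha>max < 1/3"
    and "w 0 = wm1"
    and "inertial_lin_admm f g X Y A B b \<beta> \<tau> \<eta> \<alpha> wm1 w wbar"
  shows "(\<exists>wstar \<in> Omega_star f g X Y A B b. w \<longlonglongrightarrow> wstar) \<and>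
         (\<lambda>k. MIN i\<in>{0..k-1}. (norm_wrt (G_op \<beta> \<tau> \<eta> A B) (w (Suc i) - wbar i))\<^sup>2)
           \<in> o(\<lambda>k. 1 / real k)"
proof -
  define S where "S = Omega_star f g X Y A B b"
  define G where "G = G_op \<beta> \<tau> \<eta> A B"
  \<comment> \<open>The shift by one stores the point with index -1 as \<open>v 0\<close>, so
    extrapolation has one form for all \<open>k\<close>.\<close>
  define v where "v k = (case k of 0 \<Rightarrow> wm1 | Suc j \<Rightarrow> w j)" for k
  have v_Suc [simp]: "v (Suc k) = w k" for k by (simp add: v_def)
  have "wbar k = v (Suc k) + \<alpha> k *\<^sub>R (v (Suc k) - v k) \<and>
      lin_admm_step f g X Y A B b \<beta> \<tau> \<eta> (wbar k) (w (Suc k))" for k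
    using assms(18) unfolding inertial_lin_admm_def v_Suc unfolding v_def by blast
  then have wbar: "\<And>k. wbar k = v (Suc k) + \<alpha> k *\<^sub>R (v (Suc k) - v k)"
    and step: "\<And>k. lin_admm_step f g X Y A B b \<beta> \<tau> \<eta> (wbar k) (w (Suc k))"
    by blast+
  note vi = lin_admm_step_variational_ineq[OF assms(1,3,6,8,10,11,13) step, folded G_def]
  have in_Omega: "w (Suc k) \<in> Omega X Y" for k
    using step by (rule lin_admm_step_in_Omega)
  \<comment> \<open>\<open>F_op\<close> is moved to the test point \<open>z\<close>: a solution as
    \<open>z\<close> yields the Fejer inequality, and a fixed \<open>z\<close> allows passing to the
    limit.\<close>
  have step_vi: "0 \<le> theta f g z - theta f g (w (Suc k)) + (z - w (Suc k)) \<bullet> F_op A B b z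
      + (z - w (Suc k)) \<bullet> G (w (Suc k) - wbar k)" if "z \<in> Omega X Y" for z k
    using vi[OF that, of k] F_op_skew[of z "w (Suc k)" A B b] by (simp add: inner_add_right)
  have pos: "u \<noteq> 0 \<Longrightarrow> 0 < u \<bullet> G u" for u
    unfolding G_def using assms(10-14) by (rule G_op_pos)
  have linG: "linear G" unfolding G_def by (rule linear_G_op)
  have nn: "0 \<le> u \<bullet> G u" for u
    using pos[of u] by (cases "u = 0") auto
  have fejer: "(v (Suc (Suc k)) - s) \<bullet> G (v (Suc (Suc k)) - wbar k) \<le> 0" if s: "s \<in> S" for s k
  proof -
    have "s \<in> Omega X Y"
      and "0 \<le> theta f g (w (Suc k)) - theta f g s + (w (Suc k) - s) \<bullet> F_op A B b s"
      using s in_Omega[of k] by (auto simp: S_def Omega_star_def)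
    with step_vi[of s k] show ?thesis by (simp add: inner_diff_left)
  qed
  have cluster: "l \<in> S"
    if r: "strict_mono r" and lim: "(\<lambda>k. v (Suc (Suc (r k)))) \<longlonglongrightarrow> l"
      and diff: "(\<lambda>k. v (Suc (Suc k)) - wbar k) \<longlonglongrightarrow> 0" for l r
  proof -
    have "closed (Omega X Y)"
      unfolding Omega_def using assms(5,7) by (intro closed_Times) auto
    then have l: "l \<in> Omega X Y"
      by (rule closed_sequentially[OF _ _ lim]) (simp add: in_Omega)
    \<comment> \<open>Finite convex functions on the whole space are continuous, so
      \<open>theta\<close> passes to the limit.\<close>
    have cont: "isCont f x" "isCont g y" for x y
      using convex_on_continuous[OF open_UNIV assms(1)] convex_on_continuous[OF open_UNIV assms(3)]
      by (auto simp: continuous_on_eq_continuous_at)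
    have \<theta>: "(\<lambda>k. theta f g (w (Suc (r k)))) \<longlonglongrightarrow> theta f g l"
      unfolding theta_def case_prod_unfold using lim
      by (intro tendsto_add isCont_tendsto_compose[OF cont(1)] isCont_tendsto_compose[OF cont(2)]
          tendsto_intros) simp_all
    have "(\<lambda>k. w (Suc (r k)) - wbar (r k)) \<longlonglongrightarrow> 0"
      using LIMSEQ_subseq_LIMSEQ[OF diff r] by (simp add: o_def)
    then have G0: "(\<lambda>k. G (w (Suc (r k)) - wbar (r k))) \<longlonglongrightarrow> 0"
      using linG by (intro bounded_linear.tendsto_zero[of G]) (simp_all add: linear_conv_bounded_linear)
    have "0 \<le> theta f g z - theta f g l + (z - l) \<bullet> F_op A B b l" if z: "z \<in> Omega X Y" for z
    proof -
      have "(\<lambda>k. theta f g z - theta f g (w (Suc (r k))) + (z - w (Suc (r k))) \<bullet> F_op A B b z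
          + (z - w (Suc (r k))) \<bullet> G (w (Suc (r k)) - wbar (r k)))
        \<longlonglongrightarrow> theta f g z - theta f g l + (z - l) \<bullet> F_op A B b z + (z - l) \<bullet> 0"
        using lim by (intro tendsto_intros \<theta> G0) simp_all
      then have "0 \<le> theta f g z - theta f g l + (z - l) \<bullet> F_op A B b z + (z - l) \<bullet> 0"
        by (rule LIMSEQ_le_const) (auto intro: step_vi[OF z])
      \<comment> \<open>Skewness moves \<open>F_op\<close> from \<open>z\<close> back to the limit
        \<open>l\<close>.\<close>
      then show ?thesis by (simp add: F_op_skew[of z l])
    qed
    with l show ?thesis by (simp add: S_def Omega_star_def)
  qed
  have \<alpha>: "0 \<le> \<alpha> k" "\<alpha> k \<le> \<alpha> (Suc k)" "\<alpha> k \<le> \<alpha>max" for k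
    using assms(15) by (meson order_trans)+
  have selfadj: "u \<bullet> G u' = u' \<bullet> G u" for u u'
    unfolding G_def by (rule G_op_selfadjoint)
  have ne: "S \<noteq> {}" using assms(9) by (simp add: S_def)
  note ppa = inertial_proximal_point_convergence[where v = v and vb = wbar and S = S and a = \<alpha>max,
      OF linG selfadj _ \<alpha> assms(16) wbar ne]
  have conv: "\<exists>s\<in>S. v \<longlonglongrightarrow> s"
    by (rule ppa(1)) (fact pos fejer cluster)+
  have summ: "summable (\<lambda>k. (v (Suc (Suc k)) - wbar k) \<bullet> G (v (Suc (Suc k)) - wbar k))"
    by (rule ppa(2)) (fact pos fejer cluster)+
  obtain s where s: "s \<in> S" and "v \<longlonglongrightarrow> s" using conv by blast
  from LIMSEQ_Suc[OF this(2)] have "w \<longlonglongrightarrow> s" by simp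
  with s have "\<exists>s\<in>S. w \<longlonglongrightarrow> s" by blast
  moreover have "summable (\<lambda>k. (w (Suc k) - wbar k) \<bullet> G (w (Suc k) - wbar k))"
    using summ by simp
  then have "summable (\<lambda>k. (norm_wrt G (w (Suc k) - wbar k))\<^sup>2)"
    by (simp add: norm_wrt_def nn)
  then have "(\<lambda>k. MIN i\<in>{0..k-1}. (norm_wrt G (w (Suc i) - wbar i))\<^sup>2) \<in> o(\<lambda>k. 1 / real k)"
    by (rule smallo_Min_of_summable) simp
  ultimately show ?thesis unfolding S_def G_def by blast
qed

end
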